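(* Let $\mathbb{L}=(\mathcal{P},\mathcal{C},-)$ be a miquelian Laguerre plane of characteristic distinct from $2$. Let $x,y$ be nonparallel points and $L$ a circle with $x,y\notin L$. The following conditions are equivalent: (1) There exist exactly two circles through $x$ and $y$ tangent to $L$. (2) Any circle through $x$ tangent to $L$ intersects any circle through $y$ tangent to $L$. (3) There exist two intersecting circles, tangent to $L$ in distinct points, containing $x$ and $y$ respectively.
   Context: A Laguerre plane is a structure $\mathbb{L}=(\mathcal{P},\mathcal{C},-)$ with a set $\mathcal{P}$ of points, a set $\mathcal{C}\subset 2^{\mathcal{P}}$ of circles and an equivalence relation $-$ on $\mathcal{P}$ (parallelity of points), whose classes are called generators. Axioms: (1) three pairwise nonparallel points lie on a unique circle; (2) for every circle $K$ and nonparallel points $p\in K$, $q\notin K$ there is exactly one circle $L$ through $q$ with $K\cap L=\{p\}$; (3) for any point $p$ and circle $K$ there is exactly one point $q\in K$ with $p-q$; (4) some circle contains at least three points but not all points. Two circles are tangent (in $p$) if their intersection is a single point ($\{p\}$); two circles intersect if they have at least one common point. A miquelian Laguerre plane is (up to isomorphism) the Laguerre plane over a field $\mathbb{F}$ with points $(\mathbb{F}\cup\{\infty\})\times\mathbb{F}$, with two points parallel iff they have the same first coordinate, and with circles the sets $\{(t,at^2+bt+c): t\in\mathbb{F}\}\cup\{(\infty,a)\}$ for $a,b,c\in\mathbb{F}$; its characteristic is the characteristic of $\mathbb{F}$. *)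

theory Defs
  imports "HOL-Computational_Algebra.Computational_Algebra"
begin

locale laguerre_plane =
  fixes points :: "'p set"
    and circles :: "'p set set"
    and parallel :: "('p \<times> 'p) set"
  assumes circles_subset: "circles \<subseteq> Pow points"
    and equiv_parallel: "equiv points parallel"
    and joining: "\<lbrakk>p \<in> points; q \<in> points; r \<in> points;
        (p, q) \<notin> parallel; (q, r) \<notin> parallel; (p, r) \<notin> parallel\<rbrakk>
      \<Longrightarrow> \<exists>!K. K \<in> circles \<and> p \<in> K \<and> q \<in> K \<and> r \<in> K"
    and touching: "\<lbrakk>K \<in> circles; p \<in> K; q \<in> points; q \<notin> K; (p, q) \<notin> parallel\<rbrakk>
      \<Longrightarrow> \<exists>!L. L \<in> circles \<and> q \<in> L \<and> K \<inter> L = {p}"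
    and parallel_projection: "\<lbrakk>p \<in> points; K \<in> circles\<rbrakk>
      \<Longrightarrow> \<exists>!q. q \<in> K \<and> (p, q) \<in> parallel"
    and richness: "\<exists>K \<in> circles. K \<noteq> points \<and>
      (\<exists>p \<in> K. \<exists>q \<in> K. \<exists>r \<in> K. p \<noteq> q \<and> q \<noteq> r \<and> p \<noteq> r)"

definition tangent_in :: "'p \<Rightarrow> 'p set \<Rightarrow> 'p set \<Rightarrow> bool"
  where "tangent_in p K L \<longleftrightarrow> K \<inter> L = {p}"

definition tangent :: "'p set \<Rightarrow> 'p set \<Rightarrow> bool"
  where "tangent K L \<longleftrightarrow> (\<exists>p. tangent_in p K L)"

definition intersecting :: "'p set \<Rightarrow> 'p set \<Rightarrow> bool"
  where "intersecting K L \<longleftrightarrow> K \<inter> L \<noteq> {}"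

definition laguerre_isomorphism ::
  "'p set \<Rightarrow> 'p set set \<Rightarrow> ('p \<times> 'p) set \<Rightarrow>
   'q set \<Rightarrow> 'q set set \<Rightarrow> ('q \<times> 'q) set \<Rightarrow> ('p \<Rightarrow> 'q) \<Rightarrow> bool"
  where "laguerre_isomorphism P C R P' C' R' \<phi> \<longleftrightarrow>
    bij_betw \<phi> P P' \<and>
    (\<lambda>K. \<phi> ` K) ` C = C' \<and>
    (\<forall>p \<in> P. \<forall>q \<in> P. (p, q) \<in> R \<longleftrightarrow> (\<phi> p, \<phi> q) \<in> R')"

text \<open>The Laguerre plane over a field; its point set is the whole type, and
  \<^term>\<open>None\<close> in the first coordinate stands for \<open>\<infinity>\<close>.\<close>

definition field_circle :: "'f::field \<Rightarrow> 'f \<Rightarrow> 'f \<Rightarrow> ('f option \<times> 'f) set"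
  where "field_circle a b c = {(Some t, a * t\<^sup>2 + b * t + c) | t. True} \<union> {(None, a)}"

definition field_circles :: "('f::field option \<times> 'f) set set"
  where "field_circles = {field_circle a b c | a b c. True}"

definition field_parallel :: "(('f::field option \<times> 'f) \<times> ('f option \<times> 'f)) set"
  where "field_parallel = {(p, q). fst p = fst q}"

text \<open>The dummy argument \<open>F\<close> names the coordinatising field \<^typ>\<open>'f\<close>, whose
  characteristic \<open>CHAR('f)\<close> is the characteristic of the plane.\<close>

locale miquelian_laguerre_plane = laguerre_plane points circles parallel
  for F :: "'f::field itself"
    and points :: "'p set"
    and circles :: "'p set set"
    and parallel :: "('p \<times> 'p) set" +
  assumes coordinatised: "\<exists>\<phi>. laguerre_isomorphism points circles parallel
      (UNIV :: ('f option \<times> 'f) set) field_circles field_parallel \<phi>"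

end

theory Submission
  imports Defs "HOL-Library.Product_Plus"
begin

text \<open>
  In the coordinate plane the circles are the graphs of binary quadratic forms on the projective
  line \<open>F \<union> {\<infinity>}\<close>. Only differences of forms matter, so \<open>L\<close> may be taken as the origin: a circle is
  tangent to \<open>L\<close> in a point over \<open>p\<close> iff its difference from \<open>L\<close> has \<open>p\<close> as its only zero, which
  in characteristic distinct from 2 means that the difference is \<open>l [p,w]\<^sup>2\<close> with \<open>l \<noteq> 0\<close>, where
  \<open>[p,w]\<close> is the \<open>2 \<times> 2\<close> determinant of homogeneous coordinates (\<open>unique_zero_iff_square_form\<close>).

  Let \<open>x\<close> lie over \<open>u\<close> and \<open>y\<close> over \<open>v\<close>, at heights \<open>\<alpha>\<close> and \<open>\<beta>\<close> above \<open>L\<close>; both are nonzero.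
  Each of the three conditions holds iff \<open>\<alpha> \<beta>\<close> is a square.

  For (1): a form with values \<open>\<alpha>\<close> at \<open>u\<close> and \<open>\<beta>\<close> at \<open>v\<close> is determined by its polar value \<open>b\<close> at
  \<open>(u, v)\<close>, which is arbitrary, and its discriminant vanishes iff \<open>b\<^sup>2 = 4 \<alpha> \<beta>\<close>
  (\<open>card_common_tangents\<close>).

  For (2) and (3): \<open>l [p,w]\<^sup>2 - m [q,w]\<^sup>2\<close> has discriminant \<open>4 l m [p,q]\<^sup>2\<close>. If the two squares take
  the values \<open>\<alpha>\<close> at \<open>u\<close> and \<open>\<beta>\<close> at \<open>v\<close>, then \<open>l m\<close> and \<open>\<alpha> \<beta>\<close> differ by a nonzero square. As a
  form has a zero iff its discriminant is a square, the two circles meet iff \<open>\<alpha> \<beta>\<close> is a square or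
  \<open>p = q\<close> (\<open>square_forms_meet_iff\<close>). Tangent circles with \<open>p \<noteq> q\<close> through \<open>x\<close> and \<open>y\<close> always
  exist: touch \<open>L\<close> over \<open>v\<close> and over \<open>u\<close>, respectively.
\<close>

section \<open>Binary quadratic forms on the projective line\<close>

type_synonym 'f form = "'f \<times> 'f \<times> 'f"

fun hom_x :: "'f::field option \<Rightarrow> 'f" where
  "hom_x (Some t) = t"
| "hom_x None = 1"

fun hom_y :: "'f::field option \<Rightarrow> 'f" where
  "hom_y (Some t) = 1"
| "hom_y None = 0"

definition bracket :: "'f::field option \<Rightarrow> 'f option \<Rightarrow> 'f"
  where "bracket p q = hom_x p * hom_y q - hom_y p * hom_x q"

fun form_at :: "'f::field form \<Rightarrow> 'f option \<Rightarrow> 'f" where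
  "form_at (a, b, c) w = a * (hom_x w)\<^sup>2 + b * hom_x w * hom_y w + c * (hom_y w)\<^sup>2"

fun polar_at :: "'f::field form \<Rightarrow> 'f option \<Rightarrow> 'f option \<Rightarrow> 'f" where
  "polar_at (a, b, c) u v = 2 * a * hom_x u * hom_x v
     + b * (hom_x u * hom_y v + hom_y u * hom_x v) + 2 * c * hom_y u * hom_y v"

fun disc :: "'f::field form \<Rightarrow> 'f" where
  "disc (a, b, c) = b\<^sup>2 - 4 * a * c"

text \<open>The coefficients of \<open>w \<mapsto> l [p,w]\<^sup>2\<close>.\<close>

definition square_form :: "'f::field \<Rightarrow> 'f option \<Rightarrow> 'f form"
  where "square_form l p =
    (l * (hom_y p)\<^sup>2, - 2 * l * hom_x p * hom_y p, l * (hom_x p)\<^sup>2)"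

definition unique_zero :: "'f::field form \<Rightarrow> 'f option \<Rightarrow> bool"
  where "unique_zero Q p \<longleftrightarrow> (\<forall>w. form_at Q w = 0 \<longleftrightarrow> w = p)"

lemma two_neq_zero_of_CHAR:
  assumes "CHAR('f::field) \<noteq> 2"
  shows "(2::'f) \<noteq> 0"
proof
  assume "(2::'f) = 0"
  then have "of_nat 2 = (0::'f)" by simp
  then have "CHAR('f) dvd 2" by (simp only: of_nat_eq_0_iff_char_dvd)
  then have "CHAR('f) = 1" using assms
    by (metis prime_nat_iff two_is_prime_nat)
  then show False by simp
qed

lemma bracket_eq_0_iff: "bracket p q = 0 \<longleftrightarrow> p = q"
  by (cases p; cases q) (auto simp: bracket_def)

lemma form_at_diff: "form_at (Q - R) w = form_at Q w - form_at R w"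
  by (cases Q; cases R) (simp add: algebra_simps)

lemma form_at_square_form: "form_at (square_form l p) w = l * (bracket p w)\<^sup>2"
  by (simp add: square_form_def bracket_def power2_eq_square algebra_simps)

lemma form_eqI:
  assumes "\<And>w. form_at Q w = form_at R w"
  shows "Q = R"
proof -
  obtain a b c where Q: "Q = (a, b, c)" by (cases Q)
  obtain a' b' c' where R: "R = (a', b', c')" by (cases R)
  have "a = a'" "c = c'" using assms[of None] assms[of "Some 0"] by (simp_all add: Q R)
  with assms[of "Some 1"] show ?thesis by (simp add: Q R)
qed

lemma unique_zero_square_form: "l \<noteq> 0 \<Longrightarrow> unique_zero (square_form l p) p"
  by (auto simp: unique_zero_def form_at_square_form bracket_eq_0_iff)

lemma disc_square_form: "disc (square_form l p) = 0"
  by (simp add: square_form_def power2_eq_square algebra_simps)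

lemma disc_diff_square_forms:
  "disc (square_form l p - square_form m q) = 4 * l * m * (bracket p q)\<^sup>2"
  by (simp add: square_form_def bracket_def power2_eq_square algebra_simps)

text \<open>Completing the square.\<close>

lemma has_zero_iff_disc_square:
  fixes Q :: "'f::field form"
  assumes two: "(2::'f) \<noteq> 0"
  shows "(\<exists>w. form_at Q w = 0) \<longleftrightarrow> (\<exists>s. disc Q = s\<^sup>2)"
proof -
  obtain a b c where Q: "Q = (a, b, c)" by (cases Q)
  show ?thesis
  proof (cases "a = 0")
    case True
    then have "form_at Q None = 0" "disc Q = b\<^sup>2" by (simp_all add: Q)
    then show ?thesis by blast
  next
    case False
    have complete: "4 * a * (a * t\<^sup>2 + b * t + c) = (2 * a * t + b)\<^sup>2 - disc Q" for t
      by (simp add: Q power2_eq_square algebra_simps)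
    have four: "4 * a \<noteq> 0" using two False by (metis mult_eq_0_iff numeral_Bit0_eq_double)
    show ?thesis
    proof
      assume "\<exists>w. form_at Q w = 0"
      then obtain w where w: "form_at Q w = 0" ..
      with False obtain t where "w = Some t" by (cases w) (auto simp: Q)
      with w have "a * t\<^sup>2 + b * t + c = 0" by (simp add: Q)
      with complete[of t] show "\<exists>s. disc Q = s\<^sup>2" by (metis eq_iff_diff_eq_0 mult_zero_right)
    next
      assume "\<exists>s. disc Q = s\<^sup>2"
      then obtain s where s: "disc Q = s\<^sup>2" ..
      define t where "t = (s - b) / (2 * a)"
      have "2 * a * t + b = s" using two False by (simp add: t_def)
      then have "a * t\<^sup>2 + b * t + c = 0" using complete[of t] s four by simp
      then have "form_at Q (Some t) = 0" by (simp add: Q)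
      then show "\<exists>w. form_at Q w = 0" ..
    qed
  qed
qed

lemma disc_zero_imp_square_form:
  fixes Q :: "'f::field form"
  assumes two: "(2::'f) \<noteq> 0" and "disc Q = 0" and "Q \<noteq> 0"
  obtains l p where "l \<noteq> 0" "Q = square_form l p"
proof -
  obtain a b c where Q: "Q = (a, b, c)" by (cases Q)
  have four: "(4::'f) \<noteq> 0" using two by (metis mult_eq_0_iff numeral_Bit0_eq_double)
  have b2: "b\<^sup>2 = 4 * a * c" using assms(2) by (simp add: Q)
  show ?thesis
  proof (cases "a = 0")
    case True
    then have "b = 0" using b2 by simp
    then have "c \<noteq> 0" using True assms(3) by (auto simp: Q zero_prod_def)
    moreover have "Q = square_form c None"
      using True \<open>b = 0\<close> by (simp add: Q square_form_def)
    ultimately show ?thesis by (rule that)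
  next
    case False
    have "a * (- b / (2 * a))\<^sup>2 = c"
      using False two b2 four by (simp add: power2_eq_square field_simps)
    then have "Q = square_form a (Some (- b / (2 * a)))"
      using False two by (simp add: Q square_form_def)
    with False show ?thesis by (rule that)
  qed
qed

text \<open>If \<open>a \<noteq> 0\<close>, a root in the field has a partner by Vieta, and uniqueness makes it a double
  root. If \<open>a = 0\<close>, then \<open>\<infinity>\<close> is a zero, and \<open>b \<noteq> 0\<close> would give a finite one as well.\<close>

lemma unique_zero_imp_disc_zero:
  fixes Q :: "'f::field form"
  assumes two: "(2::'f) \<noteq> 0" and uz: "unique_zero Q p"
  shows "disc Q = 0"
proof -
  obtain a b c where Q: "Q = (a, b, c)" by (cases Q)
  show ?thesis
  proof (cases "a = 0")
    case True
    have "b = 0"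
    proof (rule ccontr)
      assume "b \<noteq> 0"
      then have "form_at Q None = 0" "form_at Q (Some (- c / b)) = 0"
        using True by (simp_all add: Q)
      then show False using uz unfolding unique_zero_def by (metis option.distinct(1))
    qed
    then show ?thesis using True by (simp add: Q)
  next
    case False
    have "form_at Q p = 0" using uz by (simp add: unique_zero_def)
    with False obtain t where t: "p = Some t" "a * t\<^sup>2 + b * t + c = 0" by (cases p) (auto simp: Q)
    \<comment> \<open>The two roots of \<open>a t\<^sup>2 + b t + c\<close> have sum \<open>- b / a\<close>, so this is the other root.\<close>
    define t' where "t' = - b / a - t"
    have "a * t' = - b - a * t" using False by (simp add: t'_def algebra_simps)
    then have "a * t'\<^sup>2 + b * t' + c = a * t\<^sup>2 + b * t + c" by algebra
    then have "form_at Q (Some t') = 0" using t(2) by (simp add: Q)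
    then have "t' = t" using uz t(1) by (simp add: unique_zero_def)
    with \<open>a * t' = - b - a * t\<close> have "b = - 2 * a * t" by (simp add: algebra_simps)
    with t(2) show ?thesis unfolding Q disc.simps by algebra
  qed
qed

lemma unique_zero_iff_square_form:
  fixes Q :: "'f::field form"
  assumes two: "(2::'f) \<noteq> 0"
  shows "unique_zero Q p \<longleftrightarrow> (\<exists>l. l \<noteq> 0 \<and> Q = square_form l p)"
proof
  assume uz: "unique_zero Q p"
  have "Q \<noteq> 0"
  proof
    assume "Q = 0"
    then have "form_at Q w = 0" for w by (simp add: zero_prod_def)
    then show False using uz unfolding unique_zero_def by (metis option.distinct(1))
  qed
  then obtain l q where lq: "l \<noteq> 0" "Q = square_form l q"
    using disc_zero_imp_square_form[OF two unique_zero_imp_disc_zero[OF two uz]] by blast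
  moreover have "q = p"
    using uz unique_zero_square_form[OF lq(1), of q] by (simp add: unique_zero_def lq(2))
  ultimately show "\<exists>l. l \<noteq> 0 \<and> Q = square_form l p" by blast
qed (auto intro: unique_zero_square_form)

section \<open>Squares of linear forms with prescribed values\<close>

text \<open>The Gram determinant of \<open>u, v\<close> with respect to the polar form of \<open>Q\<close> is that of the standard
  basis times the square of the determinant of the base change.\<close>

lemma disc_base_change:
  "disc Q * (bracket u v)\<^sup>2 = (polar_at Q u v)\<^sup>2 - 4 * form_at Q u * form_at Q v"
proof (cases Q)
  case (fields a b c)
  show ?thesis unfolding fields bracket_def disc.simps polar_at.simps form_at.simps by algebra
qed

lemma form_at_expand:
  "form_at Q w * (bracket u v)\<^sup>2 = form_at Q u * (bracket w v)\<^sup>2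
     + polar_at Q u v * bracket w v * bracket u w + form_at Q v * (bracket u w)\<^sup>2"
proof (cases Q)
  case (fields a b c)
  show ?thesis unfolding fields bracket_def polar_at.simps form_at.simps by algebra
qed

lemma ex_form_with_values:
  fixes u v :: "'f::field option"
  assumes "u \<noteq> v"
  shows "\<exists>Q. form_at Q u = \<alpha> \<and> form_at Q v = \<beta> \<and> polar_at Q u v = b"
proof -
  define D where "D = (bracket u v)\<^sup>2"
  have D: "D \<noteq> 0" using assms by (simp add: D_def bracket_eq_0_iff)
  let ?xu = "hom_x u" let ?yu = "hom_y u" let ?xv = "hom_x v" let ?yv = "hom_y v"
  \<comment> \<open>The coefficients of \<open>w \<mapsto> \<alpha> [w,v]\<^sup>2 + b [w,v] [u,w] + \<beta> [u,w]\<^sup>2\<close>, to be divided by \<open>D\<close>.\<close>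
  define A where "A = \<alpha> * ?yv\<^sup>2 - b * ?yv * ?yu + \<beta> * ?yu\<^sup>2"
  define B where "B = - 2 * \<alpha> * ?xv * ?yv + b * (?yv * ?xu + ?xv * ?yu) - 2 * \<beta> * ?xu * ?yu"
  define C where "C = \<alpha> * ?xv\<^sup>2 - b * ?xv * ?xu + \<beta> * ?xu\<^sup>2"
  have "A * ?xu\<^sup>2 + B * ?xu * ?yu + C * ?yu\<^sup>2 = \<alpha> * D"
    unfolding A_def B_def C_def D_def bracket_def by algebra
  moreover have "A * ?xv\<^sup>2 + B * ?xv * ?yv + C * ?yv\<^sup>2 = \<beta> * D"
    unfolding A_def B_def C_def D_def bracket_def by algebra
  moreover have "2 * A * ?xu * ?xv + B * (?xu * ?yv + ?yu * ?xv) + 2 * C * ?yu * ?yv = b * D"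
    unfolding A_def B_def C_def D_def bracket_def by algebra
  ultimately have "form_at (A / D, B / D, C / D) u = \<alpha>" "form_at (A / D, B / D, C / D) v = \<beta>"
    "polar_at (A / D, B / D, C / D) u v = b"
    using D by (simp_all add: add_divide_distrib[symmetric])
  then show ?thesis by blast
qed

lemma form_eq_by_values:
  assumes "u \<noteq> v" and "form_at Q u = form_at R u" and "form_at Q v = form_at R v"
    and "polar_at Q u v = polar_at R u v"
  shows "Q = R"
proof (rule form_eqI)
  fix w
  have "form_at Q w * (bracket u v)\<^sup>2 = form_at R w * (bracket u v)\<^sup>2"
    by (simp only: form_at_expand[of Q w u v] form_at_expand[of R w u v] assms(2-4))
  then show "form_at Q w = form_at R w" using assms(1) by (simp add: bracket_eq_0_iff)
qed

lemma card_square_roots: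
  fixes d :: "'f::field"
  assumes two: "(2::'f) \<noteq> 0" and "d \<noteq> 0"
  shows "card {b. b\<^sup>2 = d} = 2 \<longleftrightarrow> (\<exists>s. d = s\<^sup>2)"
proof
  assume "card {b. b\<^sup>2 = d} = 2"
  then have "{b. b\<^sup>2 = d} \<noteq> {}" by (metis card.empty zero_neq_numeral)
  then show "\<exists>s. d = s\<^sup>2" by blast
next
  assume "\<exists>s. d = s\<^sup>2"
  then obtain s where s: "d = s\<^sup>2" ..
  have "s \<noteq> - s"
  proof
    assume "s = - s"
    then have "2 * s = 0" by (metis add.right_inverse mult_2)
    then show False using two s \<open>d \<noteq> 0\<close> by simp
  qed
  moreover have "{b. b\<^sup>2 = d} = {s, - s}" by (auto simp: s power2_eq_iff)
  ultimately show "card {b. b\<^sup>2 = d} = 2" by simp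
qed

text \<open>The polar value at \<open>(u, v)\<close> parametrises the forms with the given values, and those with a
  unique zero correspond to the square roots of \<open>4 \<alpha> \<beta>\<close>.\<close>

lemma card_common_tangents:
  fixes u v :: "'f::field option"
  assumes two: "(2::'f) \<noteq> 0" and uv: "u \<noteq> v" and "\<alpha> \<noteq> 0" "\<beta> \<noteq> 0"
  shows "card {Q. form_at Q u = \<alpha> \<and> form_at Q v = \<beta> \<and> (\<exists>p. unique_zero Q p)} = 2
    \<longleftrightarrow> (\<exists>s. \<alpha> * \<beta> = s\<^sup>2)"
proof -
  let ?S = "{Q. form_at Q u = \<alpha> \<and> form_at Q v = \<beta> \<and> (\<exists>p. unique_zero Q p)}"
  have four: "(4::'f) \<noteq> 0" using two by (metis mult_eq_0_iff numeral_Bit0_eq_double)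
  have tangent_iff: "(\<exists>p. unique_zero Q p) \<longleftrightarrow> (polar_at Q u v)\<^sup>2 = 4 * \<alpha> * \<beta>"
    if Q: "form_at Q u = \<alpha>" "form_at Q v = \<beta>" for Q
  proof -
    have "Q \<noteq> 0" using Q(1) \<open>\<alpha> \<noteq> 0\<close> by (auto simp: zero_prod_def)
    then have "(\<exists>p. unique_zero Q p) \<longleftrightarrow> disc Q = 0"
      by (metis disc_zero_imp_square_form[OF two] unique_zero_imp_disc_zero[OF two]
          unique_zero_square_form)
    also have "\<dots> \<longleftrightarrow> disc Q * (bracket u v)\<^sup>2 = 0" using uv by (simp add: bracket_eq_0_iff)
    also have "\<dots> \<longleftrightarrow> (polar_at Q u v)\<^sup>2 = 4 * \<alpha> * \<beta>" by (simp add: disc_base_change Q)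
    finally show ?thesis .
  qed
  have "bij_betw (\<lambda>Q. polar_at Q u v) ?S {b. b\<^sup>2 = 4 * \<alpha> * \<beta>}"
  proof (rule bij_betwI')
    fix Q R assume "Q \<in> ?S" "R \<in> ?S"
    then show "polar_at Q u v = polar_at R u v \<longleftrightarrow> Q = R"
      using form_eq_by_values[OF uv, of Q R] by auto
  next
    fix Q assume "Q \<in> ?S"
    then show "polar_at Q u v \<in> {b. b\<^sup>2 = 4 * \<alpha> * \<beta>}" using tangent_iff by blast
  next
    fix b assume "b \<in> {b. b\<^sup>2 = 4 * \<alpha> * \<beta>}"
    then show "\<exists>Q\<in>?S. b = polar_at Q u v"
      using ex_form_with_values[OF uv, of \<alpha> \<beta> b] tangent_iff by blast
  qed
  then have "card ?S = card {b. b\<^sup>2 = 4 * \<alpha> * \<beta>}" by (rule bij_betw_same_card)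
  moreover have "4 * \<alpha> * \<beta> \<noteq> 0" using assms four by simp
  moreover have "(\<exists>s. 4 * \<alpha> * \<beta> = s\<^sup>2) \<longleftrightarrow> (\<exists>s. \<alpha> * \<beta> = s\<^sup>2)"
  proof
    assume "\<exists>s. 4 * \<alpha> * \<beta> = s\<^sup>2"
    then obtain s where "4 * (\<alpha> * \<beta>) = s\<^sup>2" by (auto simp: mult.assoc)
    then have "\<alpha> * \<beta> = (s / 2)\<^sup>2"
      using four by (simp add: power_divide nonzero_eq_divide_eq mult.commute)
    then show "\<exists>s. \<alpha> * \<beta> = s\<^sup>2" ..
  next
    assume "\<exists>s. \<alpha> * \<beta> = s\<^sup>2"
    then obtain s where "\<alpha> * \<beta> = s\<^sup>2" ..
    then have "4 * \<alpha> * \<beta> = (2 * s)\<^sup>2" by (simp add: power_mult_distrib mult.assoc)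
    then show "\<exists>s. 4 * \<alpha> * \<beta> = s\<^sup>2" ..
  qed
  ultimately show ?thesis using card_square_roots[OF two, of "4 * \<alpha> * \<beta>"] by simp
qed

text \<open>For given \<open>\<alpha>\<close> and \<open>\<beta>\<close> only the zeros of the two forms matter. This is why a single
  pair of tangent circles with distinct points of contact decides whether all of them meet.\<close>

lemma square_forms_meet_iff:
  fixes u v :: "'f::field option"
  assumes two: "(2::'f) \<noteq> 0"
    and K: "unique_zero K p" "form_at K u = \<alpha>" "\<alpha> \<noteq> 0"
    and M: "unique_zero M q" "form_at M v = \<beta>" "\<beta> \<noteq> 0"
  shows "(\<exists>w. form_at (K - M) w = 0) \<longleftrightarrow> p = q \<or> (\<exists>s. \<alpha> * \<beta> = s\<^sup>2)"
proof -
  obtain l where l: "K = square_form l p"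
    using K(1) unique_zero_iff_square_form[OF two] by blast
  obtain m where m: "M = square_form m q"
    using M(1) unique_zero_iff_square_form[OF two] by blast
  define e where "e = bracket p u * bracket q v"
  have ab: "\<alpha> * \<beta> = l * m * e\<^sup>2"
    using K(2) M(2) by (auto simp: l m form_at_square_form e_def power_mult_distrib)
  then have e: "e \<noteq> 0" using K(3) M(3) by auto
  have d: "disc (K - M) = l * m * (2 * bracket p q)\<^sup>2"
    by (simp add: l m disc_diff_square_forms power_mult_distrib)
  \<comment> \<open>Both sides are \<open>l m\<close> times a square, nonzero unless \<open>p = q\<close>, so they are squares together.\<close>
  have "(\<exists>s. disc (K - M) = s\<^sup>2) \<longleftrightarrow> p = q \<or> (\<exists>s. \<alpha> * \<beta> = s\<^sup>2)"
  proof (cases "p = q")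
    case True
    then have "disc (K - M) = 0\<^sup>2" using d by (simp add: bracket_eq_0_iff)
    with True show ?thesis by blast
  next
    case False
    then have f: "2 * bracket p q \<noteq> 0" using two by (simp add: bracket_eq_0_iff)
    have square_iff: "(\<exists>s. l * m * r\<^sup>2 = s\<^sup>2) \<longleftrightarrow> (\<exists>s. l * m = s\<^sup>2)" if r: "r \<noteq> 0" for r
    proof
      assume "\<exists>s. l * m * r\<^sup>2 = s\<^sup>2"
      then obtain s where "l * m * r\<^sup>2 = s\<^sup>2" ..
      then have "l * m = (s / r)\<^sup>2" using r by (simp add: power_divide nonzero_eq_divide_eq)
      then show "\<exists>s. l * m = s\<^sup>2" ..
    next
      assume "\<exists>s. l * m = s\<^sup>2"
      then show "\<exists>s. l * m * r\<^sup>2 = s\<^sup>2" by (metis power_mult_distrib)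
    qed
    show ?thesis unfolding d ab using square_iff[OF e] square_iff[OF f] False by simp
  qed
  then show ?thesis by (simp add: has_zero_iff_disc_square[OF two])
qed

lemma ex_tangent_form:
  assumes "p \<noteq> u" and "\<alpha> \<noteq> 0"
  shows "\<exists>Q. unique_zero Q p \<and> form_at Q u = \<alpha>"
proof (intro exI conjI)
  have "bracket p u \<noteq> 0" using assms by (simp add: bracket_eq_0_iff)
  then show "form_at (square_form (\<alpha> / (bracket p u)\<^sup>2) p) u = \<alpha>"
    and "unique_zero (square_form (\<alpha> / (bracket p u)\<^sup>2) p) p"
    using assms(2) by (simp_all add: form_at_square_form unique_zero_square_form)
qed

section \<open>Circles as graphs of forms\<close>

text \<open>The two components of an isomorphism to the coordinate plane, \<open>pos\<close> for the generator of a
  point, together with the circles pulled back along it. Incidence, tangency and intersection in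
  the abstract plane become statements about forms without transporting sets of points.\<close>

locale form_coordinates =
  fixes points :: "'p set"
    and circles :: "'p set set"
    and pos :: "'p \<Rightarrow> 'f::field option"
    and height :: "'p \<Rightarrow> 'f"
    and circle :: "'f form \<Rightarrow> 'p set"
  assumes coords_inj: "\<lbrakk>z \<in> points; z' \<in> points; pos z = pos z'; height z = height z'\<rbrakk> \<Longrightarrow> z = z'"
    and coords_surj: "\<exists>z \<in> points. pos z = w \<and> height z = h"
    and circle_eq: "circle Q = {z \<in> points. form_at Q (pos z) = height z}"
    and circles_eq: "circles = range circle"
begin

lemma inj_circle: "inj circle"
proof (rule injI, rule form_eqI)
  fix Q R w
  assume eq: "circle Q = circle R"
  obtain z where z: "z \<in> points" "pos z = w" "height z = form_at Q w"
    using coords_surj by blast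
  then have "z \<in> circle Q" by (simp add: circle_eq)
  then have "z \<in> circle R" by (simp only: eq)
  then show "form_at Q w = form_at R w" using z by (simp add: circle_eq)
qed

lemma intersecting_circle_iff:
  "intersecting (circle Q) (circle R) \<longleftrightarrow> (\<exists>w. form_at (Q - R) w = 0)"
proof
  assume "intersecting (circle Q) (circle R)"
  then obtain z where "z \<in> circle Q" "z \<in> circle R" by (auto simp: intersecting_def)
  then have "form_at (Q - R) (pos z) = 0" by (simp add: circle_eq form_at_diff)
  then show "\<exists>w. form_at (Q - R) w = 0" ..
next
  assume "\<exists>w. form_at (Q - R) w = 0"
  then obtain w where w: "form_at Q w = form_at R w" by (auto simp: form_at_diff)
  obtain z where "z \<in> points" "pos z = w" "height z = form_at Q w" using coords_surj by blast
  then show "intersecting (circle Q) (circle R)" using w by (auto simp: intersecting_def circle_eq)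
qed

lemma tangent_in_circle_iff:
  "tangent_in z (circle Q) (circle R) \<longleftrightarrow> z \<in> circle R \<and> unique_zero (Q - R) (pos z)"
proof
  assume t: "tangent_in z (circle Q) (circle R)"
  have "form_at (Q - R) w = 0 \<longleftrightarrow> w = pos z" for w
  proof
    assume w: "form_at (Q - R) w = 0"
    obtain z' where "z' \<in> points" "pos z' = w" "height z' = form_at Q w" using coords_surj by blast
    then have "z' \<in> circle Q \<inter> circle R" using w by (auto simp: circle_eq form_at_diff)
    then have "z' = z" using t unfolding tangent_in_def by blast
    then show "w = pos z" using \<open>pos z' = w\<close> by simp
  next
    have "z \<in> circle Q" "z \<in> circle R" using t by (auto simp: tangent_in_def)
    then show "w = pos z \<Longrightarrow> form_at (Q - R) w = 0" by (auto simp: circle_eq form_at_diff)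
  qed
  then show "z \<in> circle R \<and> unique_zero (Q - R) (pos z)"
    using t by (auto simp: unique_zero_def tangent_in_def)
next
  assume "z \<in> circle R \<and> unique_zero (Q - R) (pos z)"
  then have z: "z \<in> points" "form_at R (pos z) = height z"
    and zero_iff: "form_at Q w = form_at R w \<longleftrightarrow> w = pos z" for w
    by (simp_all add: circle_eq unique_zero_def form_at_diff)
  have "z' = z" if z': "z' \<in> points" "form_at Q (pos z') = height z'" "form_at R (pos z') = height z'"
    for z'
  proof (rule coords_inj)
    show "pos z' = pos z" using zero_iff z'(2,3) by metis
    then show "height z' = height z" using z(2) z'(3) by metis
  qed fact+
  moreover have "form_at Q (pos z) = height z" using zero_iff z(2) by metis
  ultimately show "tangent_in z (circle Q) (circle R)"
    unfolding tangent_in_def circle_eq using z by blast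
qed

lemma ex_point_on_circle: "\<exists>z \<in> circle R. pos z = w"
  using coords_surj[of w "form_at R w"] by (auto simp: circle_eq)

lemma tangent_circle_iff:
  "tangent (circle Q) (circle R) \<longleftrightarrow> (\<exists>p. unique_zero (Q - R) p)"
  unfolding tangent_def tangent_in_circle_iff using ex_point_on_circle by metis

lemma on_circle_iff:
  "z \<in> points \<Longrightarrow> z \<in> circle Q \<longleftrightarrow> form_at (Q - R) (pos z) = height z - form_at R (pos z)"
  by (auto simp: circle_eq form_at_diff)

text \<open>Subtracting \<open>R\<close> from every form moves the circle \<open>circle R\<close> to the origin, and \<open>\<alpha>\<close> and \<open>\<beta>\<close>
  become the prescribed values at \<open>pos x\<close> and \<open>pos y\<close>.\<close>

lemma
  fixes x y :: 'p and R :: "'f form"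
  defines "\<alpha> \<equiv> height x - form_at R (pos x)" and "\<beta> \<equiv> height y - form_at R (pos y)"
  assumes two: "(2::'f) \<noteq> 0" and x: "x \<in> points" "x \<notin> circle R"
    and y: "y \<in> points" "y \<notin> circle R" and xy: "pos x \<noteq> pos y"
  shows card_tangents_iff_square:
      "card {K \<in> circles. x \<in> K \<and> y \<in> K \<and> tangent K (circle R)} = 2
        \<longleftrightarrow> (\<exists>s. \<alpha> * \<beta> = s\<^sup>2)"
    and all_tangents_meet_iff_square:
      "(\<forall>K \<in> circles. \<forall>M \<in> circles. x \<in> K \<and> tangent K (circle R) \<and> y \<in> M \<and> tangent M (circle R)
          \<longrightarrow> intersecting K M) \<longleftrightarrow> (\<exists>s. \<alpha> * \<beta> = s\<^sup>2)"
    and some_tangents_meet_iff_square: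
      "(\<exists>K \<in> circles. \<exists>M \<in> circles. \<exists>p q. p \<noteq> q \<and> tangent_in p K (circle R)
          \<and> tangent_in q M (circle R) \<and> x \<in> K \<and> y \<in> M \<and> intersecting K M)
        \<longleftrightarrow> (\<exists>s. \<alpha> * \<beta> = s\<^sup>2)"
proof -
  have \<alpha>0: "\<alpha> \<noteq> 0" and \<beta>0: "\<beta> \<noteq> 0" using x y by (auto simp: circle_eq \<alpha>_def \<beta>_def)
  have onx: "x \<in> circle Q \<longleftrightarrow> form_at (Q - R) (pos x) = \<alpha>" for Q
    unfolding \<alpha>_def by (rule on_circle_iff[OF x(1)])
  have ony: "y \<in> circle Q \<longleftrightarrow> form_at (Q - R) (pos y) = \<beta>" for Q
    unfolding \<beta>_def by (rule on_circle_iff[OF y(1)])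
  have meet: "intersecting (circle K) (circle M) \<longleftrightarrow> p = q \<or> (\<exists>s. \<alpha> * \<beta> = s\<^sup>2)"
    if "unique_zero (K - R) p" "x \<in> circle K" "unique_zero (M - R) q" "y \<in> circle M" for K M p q
  proof -
    have "(K - R) - (M - R) = K - M" by simp
    then show ?thesis
      using square_forms_meet_iff[OF two that(1) _ \<alpha>0 that(3) _ \<beta>0] that(2,4)
      by (simp add: onx ony intersecting_circle_iff)
  qed
  show "card {K \<in> circles. x \<in> K \<and> y \<in> K \<and> tangent K (circle R)} = 2
      \<longleftrightarrow> (\<exists>s. \<alpha> * \<beta> = s\<^sup>2)"
  proof -
    let ?S = "{Q. form_at Q (pos x) = \<alpha> \<and> form_at Q (pos y) = \<beta> \<and> (\<exists>p. unique_zero Q p)}"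
    have "{K \<in> circles. x \<in> K \<and> y \<in> K \<and> tangent K (circle R)} = (\<lambda>Q. circle (Q + R)) ` ?S"
    proof (intro equalityI subsetI)
      fix K assume K: "K \<in> {K \<in> circles. x \<in> K \<and> y \<in> K \<and> tangent K (circle R)}"
      then obtain Q where Q: "K = circle Q" by (auto simp: circles_eq)
      then have "Q - R \<in> ?S" using K by (simp add: onx ony tangent_circle_iff)
      moreover have "K = circle ((Q - R) + R)" by (simp add: Q)
      ultimately show "K \<in> (\<lambda>Q. circle (Q + R)) ` ?S" by blast
    qed (auto simp: onx ony tangent_circle_iff circles_eq)
    moreover have "inj_on (\<lambda>Q. circle (Q + R)) ?S"
      by (rule inj_onI) (metis add_right_cancel inj_circle injD)
    ultimately show ?thesis
      using card_common_tangents[OF two xy \<alpha>0 \<beta>0] by (simp add: card_image)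
  qed
  \<comment> \<open>Tangent circles with distinct points of contact, so that whether they meet decides the matter.\<close>
  obtain K0 p0 M0 q0 where witness: "x \<in> circle K0" "tangent_in p0 (circle K0) (circle R)"
    "y \<in> circle M0" "tangent_in q0 (circle M0) (circle R)" "pos p0 \<noteq> pos q0"
  proof -
    obtain K where K: "unique_zero K (pos y)" "form_at K (pos x) = \<alpha>"
      using ex_tangent_form[of "pos y" "pos x" \<alpha>] xy \<alpha>0 by auto
    obtain M where M: "unique_zero M (pos x)" "form_at M (pos y) = \<beta>"
      using ex_tangent_form[of "pos x" "pos y" \<beta>] xy \<beta>0 by auto
    obtain p q where "p \<in> circle R" "pos p = pos y" "q \<in> circle R" "pos q = pos x"
      using ex_point_on_circle by metis
    then show thesis
      using K M xy by (intro that[of "K + R" p "M + R" q]) (auto simp: onx ony tangent_in_circle_iff)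
  qed
  have witness_meet: "intersecting (circle K0) (circle M0) \<longleftrightarrow> (\<exists>s. \<alpha> * \<beta> = s\<^sup>2)"
    using meet[of K0 "pos p0" M0 "pos q0"] witness by (simp add: tangent_in_circle_iff)
  show "(\<forall>K \<in> circles. \<forall>M \<in> circles. x \<in> K \<and> tangent K (circle R) \<and> y \<in> M \<and> tangent M (circle R)
          \<longrightarrow> intersecting K M) \<longleftrightarrow> (\<exists>s. \<alpha> * \<beta> = s\<^sup>2)" (is "?all \<longleftrightarrow> _")
  proof
    assume ?all
    then have "intersecting (circle K0) (circle M0)"
      using witness unfolding tangent_def circles_eq by blast
    then show "\<exists>s. \<alpha> * \<beta> = s\<^sup>2" by (simp add: witness_meet)
  next
    assume "\<exists>s. \<alpha> * \<beta> = s\<^sup>2"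
    then have "intersecting (circle K) (circle M)"
      if "x \<in> circle K" "tangent (circle K) (circle R)" "y \<in> circle M" "tangent (circle M) (circle R)"
      for K M
      using that meet unfolding tangent_circle_iff by blast
    then show ?all unfolding circles_eq by blast
  qed
  show "(\<exists>K \<in> circles. \<exists>M \<in> circles. \<exists>p q. p \<noteq> q \<and> tangent_in p K (circle R)
          \<and> tangent_in q M (circle R) \<and> x \<in> K \<and> y \<in> M \<and> intersecting K M)
        \<longleftrightarrow> (\<exists>s. \<alpha> * \<beta> = s\<^sup>2)" (is "?some \<longleftrightarrow> _")
  proof
    assume ?some
    then obtain K M p q where KM: "p \<noteq> q" "tangent_in p (circle K) (circle R)"
      "tangent_in q (circle M) (circle R)" "x \<in> circle K" "y \<in> circle M"
      "intersecting (circle K) (circle M)"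
      by (auto simp: circles_eq)
    \<comment> \<open>Distinct points of the circle \<open>circle R\<close> lie on distinct generators.\<close>
    then have "p \<in> circle R" "q \<in> circle R" by (simp_all add: tangent_in_circle_iff)
    then have "pos p \<noteq> pos q"
      using coords_inj[of p q] \<open>p \<noteq> q\<close> by (auto simp: circle_eq)
    then show "\<exists>s. \<alpha> * \<beta> = s\<^sup>2"
      using meet[of K "pos p" M "pos q"] KM by (simp add: tangent_in_circle_iff)
  next
    assume "\<exists>s. \<alpha> * \<beta> = s\<^sup>2"
    then have "intersecting (circle K0) (circle M0)" by (simp add: witness_meet)
    moreover have "p0 \<noteq> q0" using witness(5) by auto
    ultimately show ?some using witness unfolding circles_eq by blast
  qed
qed

end

section \<open>Coordinates of a miquelian Laguerre plane\<close>

lemma field_circle_eq_graph: "field_circle a b c = {z. form_at (a, b, c) (fst z) = snd z}"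
proof (rule set_eqI)
  fix z :: "'a option \<times> 'a"
  obtain w h where z: "z = (w, h)" by (cases z)
  show "z \<in> field_circle a b c \<longleftrightarrow> z \<in> {z. form_at (a, b, c) (fst z) = snd z}"
    by (cases w) (auto simp: z field_circle_def)
qed

lemma form_coordinates_of_isomorphism:
  fixes \<phi> :: "'p \<Rightarrow> 'f::field option \<times> 'f"
  assumes iso: "laguerre_isomorphism points circles parallel UNIV field_circles field_parallel \<phi>"
    and sub: "circles \<subseteq> Pow points"
  shows "form_coordinates points circles (fst \<circ> \<phi>) (snd \<circ> \<phi>)
    (\<lambda>Q. {z \<in> points. form_at Q (fst (\<phi> z)) = snd (\<phi> z)})"
proof
  have bij: "bij_betw \<phi> points UNIV" and img: "(\<lambda>K. \<phi> ` K) ` circles = field_circles"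
    using iso by (auto simp: laguerre_isomorphism_def)
  show "z = z'" if "z \<in> points" "z' \<in> points" "(fst \<circ> \<phi>) z = (fst \<circ> \<phi>) z'"
    "(snd \<circ> \<phi>) z = (snd \<circ> \<phi>) z'" for z z'
    using that bij by (auto simp: bij_betw_def inj_on_def prod_eq_iff)
  show "\<exists>z\<in>points. (fst \<circ> \<phi>) z = w \<and> (snd \<circ> \<phi>) z = h" for w h
  proof -
    have "(w, h) \<in> \<phi> ` points" using bij by (simp add: bij_betw_def)
    then obtain z where "z \<in> points" "\<phi> z = (w, h)" by auto
    then show ?thesis by (intro bexI[of _ z]) simp_all
  qed
  let ?graph = "\<lambda>Q. {z. form_at Q (fst z) = snd z}"
  have graphs: "field_circles = range ?graph"
    by (auto simp: field_circles_def field_circle_eq_graph image_def)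
  have preimage: "{z \<in> points. \<phi> z \<in> \<phi> ` K} = K" if "K \<subseteq> points" for K
    using that bij unfolding bij_betw_def by (auto dest: inj_onD)
  have pull: "{z \<in> points. form_at Q (fst (\<phi> z)) = snd (\<phi> z)} = K"
    if "K \<in> circles" "\<phi> ` K = ?graph Q" for K Q
  proof -
    have "{z \<in> points. form_at Q (fst (\<phi> z)) = snd (\<phi> z)} = {z \<in> points. \<phi> z \<in> \<phi> ` K}"
      unfolding that(2) by simp
    also have "\<dots> = K" using that(1) sub by (intro preimage) blast
    finally show ?thesis .
  qed
  show "circles = range (\<lambda>Q. {z \<in> points. form_at Q (fst (\<phi> z)) = snd (\<phi> z)})"
  proof (intro equalityI subsetI)
    fix K assume K: "K \<in> circles"
    then have "\<phi> ` K \<in> range ?graph" using img graphs by blast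
    then obtain Q where "\<phi> ` K = ?graph Q" by (rule rangeE)
    from pull[OF K this, symmetric]
    show "K \<in> range (\<lambda>Q. {z \<in> points. form_at Q (fst (\<phi> z)) = snd (\<phi> z)})"
      by (rule range_eqI)
  next
    fix K assume "K \<in> range (\<lambda>Q. {z \<in> points. form_at Q (fst (\<phi> z)) = snd (\<phi> z)})"
    then obtain Q where Q: "K = {z \<in> points. form_at Q (fst (\<phi> z)) = snd (\<phi> z)}"
      by (rule rangeE)
    have "?graph Q \<in> (\<lambda>K. \<phi> ` K) ` circles" unfolding img graphs by (rule rangeI)
    then obtain K' where "?graph Q = \<phi> ` K'" "K' \<in> circles" by (rule imageE)
    with pull[of K' Q] show "K \<in> circles" by (simp only: Q)
  qed
qed simp

theorem theorem4p2:
  fixes points :: "'p set"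
    and circles :: "'p set set"
    and parallel :: "('p \<times> 'p) set"
    and x y :: 'p
    and L :: "'p set"
  assumes "miquelian_laguerre_plane TYPE('f::field) points circles parallel"
    and "CHAR('f) \<noteq> 2"
    and "x \<in> points" and "y \<in> points" and "(x, y) \<notin> parallel"
    and "L \<in> circles" and "x \<notin> L" and "y \<notin> L"
  shows "((card {K \<in> circles. x \<in> K \<and> y \<in> K \<and> tangent K L} = 2)
      \<longleftrightarrow> (\<forall>K \<in> circles. \<forall>M \<in> circles.
        x \<in> K \<and> tangent K L \<and> y \<in> M \<and> tangent M L \<longrightarrow> intersecting K M))
    \<and> ((\<forall>K \<in> circles. \<forall>M \<in> circles.
        x \<in> K \<and> tangent K L \<and> y \<in> M \<and> tangent M L \<longrightarrow> intersecting K M)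
      \<longleftrightarrow> (\<exists>K \<in> circles. \<exists>M \<in> circles. \<exists>p q. p \<noteq> q \<and>
        tangent_in p K L \<and> tangent_in q M L \<and> x \<in> K \<and> y \<in> M \<and> intersecting K M))"
proof -
  interpret miquelian_laguerre_plane "TYPE('f)" points circles parallel by (rule assms(1))
  obtain \<phi> :: "'p \<Rightarrow> 'f option \<times> 'f" where iso:
    "laguerre_isomorphism points circles parallel UNIV field_circles field_parallel \<phi>"
    using coordinatised by blast
  define circle :: "'f form \<Rightarrow> 'p set"
    where "circle Q = {z \<in> points. form_at Q (fst (\<phi> z)) = snd (\<phi> z)}" for Q
  interpret form_coordinates points circles "fst \<circ> \<phi>" "snd \<circ> \<phi>" circle
    using form_coordinates_of_isomorphism[OF iso circles_subset]
    unfolding circle_def[abs_def] .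
  obtain R where R: "L = circle R" using \<open>L \<in> circles\<close> circles_eq by auto
  have "(fst \<circ> \<phi>) x \<noteq> (fst \<circ> \<phi>) y"
    using iso assms(3-5) by (auto simp: laguerre_isomorphism_def field_parallel_def)
  note conditions = two_neq_zero_of_CHAR[OF assms(2)] assms(3) assms(7)[unfolded R]
    assms(4) assms(8)[unfolded R] this
  show ?thesis
    unfolding R card_tangents_iff_square[OF conditions] all_tangents_meet_iff_square[OF conditions]
      some_tangents_meet_iff_square[OF conditions] by simp
qed

end
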